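(* Let $n\geq 1$. There is no isometric embedding of $\mathbb{R}^{n+1}$ into $\mathscr{W}_2(\mathbb{R}^n)$.
   Context: $\mathbb{R}^k$ carries its Euclidean distance. $\mathscr{W}_2(\mathbb{R}^n)$ is the set of Borel probability measures on $\mathbb{R}^n$ with finite second moment, endowed with the quadratic Wasserstein distance $d_{\mathscr W}^2(\mu_0,\mu_1)=\inf_\Pi\int |x-y|^2\,\Pi(dx\,dy)$, the infimum being over all couplings $\Pi$ of $\mu_0,\mu_1$. An isometric embedding is a (not necessarily surjective) distance-preserving map. *)

theory Defs
  imports "HOL-Probability.Probability"
begin

definition wasserstein_space :: "'a::euclidean_space measure set" where
  "wasserstein_space =
     {\<mu>. prob_space \<mu> \<and> sets \<mu> = sets borel \<and> integrable \<mu> (\<lambda>x. (norm x)\<^sup>2)}"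

definition couplings :: "'a::euclidean_space measure \<Rightarrow> 'a measure \<Rightarrow> ('a \<times> 'a) measure set" where
  "couplings \<mu> \<nu> =
     {\<gamma>. prob_space \<gamma> \<and> sets \<gamma> = sets borel \<and>
          distr \<gamma> borel fst = \<mu> \<and> distr \<gamma> borel snd = \<nu>}"

text \<open>The cost is computed in \<open>[0, \<infinity>]\<close>. For \<open>\<mu>\<close> and \<open>\<nu>\<close> in \<open>wasserstein_space\<close> the product
  coupling has finite cost, so the infimum is finite and \<open>enn2real\<close> loses nothing; outside
  that set the value has no meaning.\<close>

definition wasserstein_dist :: "'a::euclidean_space measure \<Rightarrow> 'a measure \<Rightarrow> real" where
  "wasserstein_dist \<mu> \<nu> =
     sqrt (enn2real (INF \<gamma>\<in>couplings \<mu> \<nu>. \<integral>\<^sup>+ (x, y). ennreal ((dist x y)\<^sup>2) \<partial>\<gamma>))"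

definition isometric_embedding ::
    "'a set \<Rightarrow> ('a \<Rightarrow> 'a \<Rightarrow> real) \<Rightarrow> 'b set \<Rightarrow> ('b \<Rightarrow> 'b \<Rightarrow> real) \<Rightarrow> ('a \<Rightarrow> 'b) \<Rightarrow> bool" where
  "isometric_embedding X dX Y dY f \<longleftrightarrow>
     f \<in> X \<rightarrow> Y \<and> (\<forall>x\<in>X. \<forall>y\<in>X. dY (f x) (f y) = dX x y)"

end

theory Submission
  imports Defs "HOL-Real_Asymp.Real_Asymp"
begin

text \<open>
  An isometric embedding \<open>\<phi>\<close> of \<open>\<real>\<^sup>m\<close> into the Wasserstein space
  of \<open>\<real>\<^sup>n\<close> forces \<open>m \<le> n\<close>, because on large scales the barycenters
  of the measures \<open>\<phi> x\<close> must reproduce the inner products of the points \<open>x\<close>.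
  The measures at \<open>x\<close> and \<open>- x\<close> are at squared distance
  \<open>4 \<bar>x\<bar>\<^sup>2\<close>, while their second moments add up to only about
  \<open>2 \<bar>x\<bar>\<^sup>2\<close>. Coupling them independently, at a cost in which the
  barycenters enter through their inner product, can make up the difference only if the barycenters
  are nearly opposite and nearly as long as \<open>x\<close>.

  Two estimates make this precise. Testing with the product coupling
  (\<open>wasserstein_dist_le_product_cost\<close>) bounds a squared distance above by the two second
  moments minus twice the inner product of the barycenters. Testing an arbitrary coupling with
  Young's inequality (\<open>second_moment_le\<close>) shows that the second moment of
  \<open>\<phi> x\<close> is at most \<open>\<bar>x\<bar>\<^sup>2\<close> plus a term linear in
  \<open>\<bar>x\<bar>\<close>. For unit vectors \<open>u\<close>, \<open>v\<close>, the barycenters of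
  \<open>\<phi> (t u)\<close> and \<open>\<phi> (t v)\<close>, divided by \<open>t\<close>, therefore have
  inner product at most \<open>u \<bullet> v + o(1)\<close> and norm at most \<open>1 + o(1)\<close>
  as \<open>t\<close> tends to infinity.

  Apply this to the standard basis vectors and their negatives, and pass to the limit along a
  subsequence. The limit vectors satisfy one-sided inequalities, but having both signs available
  turns them into equalities (\<open>orthonormal_of_inner_bounds\<close>): antipodal limits are
  opposite, so the limits of the basis vectors form an orthonormal family of size \<open>m\<close> in
  \<open>\<real>\<^sup>n\<close>.
\<close>

section \<open>Second moments and barycenters\<close>

definition second_moment :: "'a::euclidean_space measure \<Rightarrow> real" where
  "second_moment \<mu> = (\<integral>x. (norm x)\<^sup>2 \<partial>\<mu>)"

definition barycenter :: "'a::euclidean_space measure \<Rightarrow> 'a" where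
  "barycenter \<mu> = (\<integral>x. x \<partial>\<mu>)"

lemma wasserstein_spaceD:
  assumes "\<mu> \<in> wasserstein_space"
  shows "prob_space \<mu>" "sets \<mu> = sets borel" "integrable \<mu> (\<lambda>x. (norm x)\<^sup>2)"
  using assms by (auto simp: wasserstein_space_def)

lemma integrable_ident_wasserstein_space:
  assumes "\<mu> \<in> wasserstein_space"
  shows "integrable \<mu> (\<lambda>x. x)"
proof -
  note mu [measurable_cong, simp] = wasserstein_spaceD[OF assms]
  interpret prob_space \<mu> by fact
  show ?thesis
  proof (rule Bochner_Integration.integrable_bound)
    show "integrable \<mu> (\<lambda>x. 1 + (norm x)\<^sup>2)" using mu(3) by simp
    have "r \<le> 1 + r\<^sup>2" for r :: real
      using sum_squares_bound[of r 1] zero_le_power2[of "r + 1"]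
      by (cases "r \<ge> 0") (auto intro: order_trans[of _ 0])
    then show "AE x in \<mu>. norm x \<le> norm (1 + (norm x)\<^sup>2)" by (simp add: abs_of_nonneg)
  qed simp
qed

lemma power2_norm_diff:
  fixes x y :: "'a::real_inner"
  shows "(norm (x - y))\<^sup>2 = (norm x)\<^sup>2 + (norm y)\<^sup>2 - 2 * (x \<bullet> y)"
  by (simp add: power2_norm_eq_inner inner_diff inner_commute)

text \<open>The difference of the two sides is the variance.\<close>
lemma norm_barycenter_le:
  assumes "\<mu> \<in> wasserstein_space"
  shows "(norm (barycenter \<mu>))\<^sup>2 \<le> second_moment \<mu>"
proof -
  note mu [measurable_cong, simp] = wasserstein_spaceD[OF assms]
  note int [simp] = integrable_ident_wasserstein_space[OF assms]
  interpret prob_space \<mu> by fact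
  let ?b = "barycenter \<mu>"
  have "0 \<le> (\<integral>x. (norm (x - ?b))\<^sup>2 \<partial>\<mu>)" by simp
  also have "\<dots> = (\<integral>x. (norm x)\<^sup>2 + (norm ?b)\<^sup>2 - 2 * (x \<bullet> ?b) \<partial>\<mu>)"
    by (simp add: power2_norm_diff)
  also have "\<dots> = second_moment \<mu> + (norm ?b)\<^sup>2 - 2 * (?b \<bullet> ?b)"
    using mu(3) by (simp add: second_moment_def barycenter_def prob_space)
  finally show ?thesis by (simp add: power2_norm_eq_inner)
qed

section \<open>Bounds on the Wasserstein distance\<close>

lemma product_coupling:
  assumes "\<mu> \<in> wasserstein_space" "\<nu> \<in> wasserstein_space"
  shows "\<mu> \<Otimes>\<^sub>M \<nu> \<in> couplings \<mu> \<nu>"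
proof -
  note mu [measurable_cong] = wasserstein_spaceD[OF assms(1)]
  note nu [measurable_cong] = wasserstein_spaceD[OF assms(2)]
  interpret M: prob_space \<mu> by fact
  interpret N: prob_space \<nu> by fact
  interpret P: pair_prob_space \<mu> \<nu> ..
  have s: "sets (\<mu> \<Otimes>\<^sub>M \<nu>) = sets borel"
    by (metis borel_prod mu(2) nu(2) sets_pair_measure_cong)
  have f: "distr (\<mu> \<Otimes>\<^sub>M \<nu>) borel fst = \<mu>"
    using N.distr_pair_fst[of \<mu>] mu(2) by (simp cong: distr_cong)
  have g: "distr (\<mu> \<Otimes>\<^sub>M \<nu>) borel snd = \<nu>"
  proof (rule measure_eqI)
    fix A assume "A \<in> sets (distr (\<mu> \<Otimes>\<^sub>M \<nu>) borel snd)"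
    then have A: "A \<in> sets \<nu>" using nu(2) by simp
    have "snd -` A \<inter> space (\<mu> \<Otimes>\<^sub>M \<nu>) = space \<mu> \<times> A"
      using sets.sets_into_space[OF A] by (auto simp: space_pair_measure)
    then have "emeasure (distr (\<mu> \<Otimes>\<^sub>M \<nu>) borel snd) A = emeasure (\<mu> \<Otimes>\<^sub>M \<nu>) (space \<mu> \<times> A)"
      using A nu(2) by (simp add: emeasure_distr)
    then show "emeasure (distr (\<mu> \<Otimes>\<^sub>M \<nu>) borel snd) A = emeasure \<nu> A"
      using A by (simp add: N.emeasure_pair_measure_Times M.emeasure_space_1)
  qed (simp add: nu(2))
  show ?thesis unfolding couplings_def using s f g P.prob_space_axioms by simp
qed

text \<open>Expand the square; under the product measure the two coordinates are independent, so
  the mixed term integrates to the inner product of the barycenters.\<close>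
lemma product_coupling_cost:
  assumes "\<mu> \<in> wasserstein_space" "\<nu> \<in> wasserstein_space"
  shows "(\<integral>\<^sup>+ (x, y). ennreal ((dist x y)\<^sup>2) \<partial>(\<mu> \<Otimes>\<^sub>M \<nu>)) =
    ennreal (second_moment \<mu> + second_moment \<nu> - 2 * (barycenter \<mu> \<bullet> barycenter \<nu>))"
proof -
  note mu [measurable_cong] = wasserstein_spaceD[OF assms(1)]
  note nu [measurable_cong] = wasserstein_spaceD[OF assms(2)]
  note int = integrable_ident_wasserstein_space[OF assms(1)] integrable_ident_wasserstein_space[OF assms(2)]
  interpret M: prob_space \<mu> by fact
  interpret N: prob_space \<nu> by fact
  interpret P: pair_prob_space \<mu> \<nu> ..
  let ?g = "\<mu> \<Otimes>\<^sub>M \<nu>"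
  have d: "distr ?g borel fst = \<mu>" "distr ?g borel snd = \<nu>"
    using product_coupling[OF assms] by (auto simp: couplings_def)
  have i1: "integrable ?g (\<lambda>z. (norm (fst z))\<^sup>2)"
    using integrable_distr_eq[of fst ?g borel "\<lambda>x. (norm x)\<^sup>2"] mu(3) by (simp add: d)
  have i2: "integrable ?g (\<lambda>z. (norm (snd z))\<^sup>2)"
    using integrable_distr_eq[of snd ?g borel "\<lambda>x. (norm x)\<^sup>2"] nu(3) by (simp add: d)
  have i3: "integrable ?g (\<lambda>z. fst z \<bullet> snd z)"
  proof (rule Bochner_Integration.integrable_bound)
    show "integrable ?g (\<lambda>z. (norm (fst z))\<^sup>2 + (norm (snd z))\<^sup>2)" using i1 i2 by simp
    have "\<bar>x \<bullet> y\<bar> \<le> (norm x)\<^sup>2 + (norm y)\<^sup>2" for x y :: 'a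
    proof -
      have "0 \<le> norm x * norm y" by simp
      moreover have "2 * (norm x * norm y) \<le> (norm x)\<^sup>2 + (norm y)\<^sup>2"
        using sum_squares_bound[of "norm x" "norm y"] by (simp add: mult.assoc)
      ultimately show ?thesis using Cauchy_Schwarz_ineq2[of x y] by linarith
    qed
    then show "AE z in ?g. norm (fst z \<bullet> snd z) \<le> norm ((norm (fst z))\<^sup>2 + (norm (snd z))\<^sup>2)"
      by simp
  qed simp
  have e1: "(\<integral>z. (norm (fst z))\<^sup>2 \<partial>?g) = second_moment \<mu>"
    using integral_distr[of fst ?g borel "\<lambda>x. (norm x)\<^sup>2"] by (simp add: d second_moment_def)
  have e2: "(\<integral>z. (norm (snd z))\<^sup>2 \<partial>?g) = second_moment \<nu>"
    using integral_distr[of snd ?g borel "\<lambda>x. (norm x)\<^sup>2"] by (simp add: d second_moment_def)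
  have e3: "(\<integral>z. fst z \<bullet> snd z \<partial>?g) = barycenter \<mu> \<bullet> barycenter \<nu>"
    using P.integral_fst'[OF i3] int by (simp add: barycenter_def)
  have "(\<integral>\<^sup>+ (x, y). ennreal ((dist x y)\<^sup>2) \<partial>?g) =
      (\<integral>\<^sup>+ z. ennreal ((norm (fst z))\<^sup>2 + (norm (snd z))\<^sup>2 - 2 * (fst z \<bullet> snd z)) \<partial>?g)"
    by (intro nn_integral_cong) (simp add: dist_norm power2_norm_diff split: prod.split)
  also have "\<dots> = ennreal (\<integral>z. (norm (fst z))\<^sup>2 + (norm (snd z))\<^sup>2 - 2 * (fst z \<bullet> snd z) \<partial>?g)"
  proof (rule nn_integral_eq_integral)
    have "0 \<le> (norm x)\<^sup>2 + (norm y)\<^sup>2 - 2 * (x \<bullet> y)" for x y :: 'a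
      using zero_le_power2[of "norm (x - y)"] by (simp only: power2_norm_diff)
    then show "AE z in ?g. 0 \<le> (norm (fst z))\<^sup>2 + (norm (snd z))\<^sup>2 - 2 * (fst z \<bullet> snd z)"
      by blast
  qed (use i1 i2 i3 in simp)
  finally show ?thesis using i1 i2 i3 by (simp add: e1 e2 e3)
qed

text \<open>The product coupling makes the infimum finite, so the distance can be squared back to
  the infimum as an extended real; this is how both bounds below reach the definition.\<close>
lemma wasserstein_cost_eq:
  assumes "\<mu> \<in> wasserstein_space" "\<nu> \<in> wasserstein_space"
  shows "(INF \<gamma>\<in>couplings \<mu> \<nu>. \<integral>\<^sup>+ (x, y). ennreal ((dist x y)\<^sup>2) \<partial>\<gamma>) =
    ennreal ((wasserstein_dist \<mu> \<nu>)\<^sup>2)" (is "?I = _")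
proof -
  have "?I \<le> (\<integral>\<^sup>+ (x, y). ennreal ((dist x y)\<^sup>2) \<partial>(\<mu> \<Otimes>\<^sub>M \<nu>))"
    by (rule INF_lower[OF product_coupling[OF assms]])
  also have "\<dots> < \<top>" by (simp add: product_coupling_cost[OF assms])
  finally show ?thesis by (simp add: wasserstein_dist_def)
qed

lemma wasserstein_dist_le_product_cost:
  assumes "\<mu> \<in> wasserstein_space" "\<nu> \<in> wasserstein_space"
  shows "(wasserstein_dist \<mu> \<nu>)\<^sup>2 \<le>
    second_moment \<mu> + second_moment \<nu> - 2 * (barycenter \<mu> \<bullet> barycenter \<nu>)" (is "_ \<le> ?R")
proof -
  have "ennreal ((wasserstein_dist \<mu> \<nu>)\<^sup>2) \<le> ennreal ?R"
    using INF_lower[OF product_coupling[OF assms], of "\<lambda>\<gamma>. \<integral>\<^sup>+ (x, y). ennreal ((dist x y)\<^sup>2) \<partial>\<gamma>"]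
    by (simp add: wasserstein_cost_eq[OF assms] product_coupling_cost[OF assms])
  moreover have "0 \<le> ?R"
  proof -
    have "2 * (barycenter \<mu> \<bullet> barycenter \<nu>) \<le> (norm (barycenter \<mu>))\<^sup>2 + (norm (barycenter \<nu>))\<^sup>2"
      using zero_le_power2[of "norm (barycenter \<mu> - barycenter \<nu>)"] by (simp add: power2_norm_diff)
    with norm_barycenter_le[OF assms(1)] norm_barycenter_le[OF assms(2)] show ?thesis by simp
  qed
  ultimately show ?thesis by simp
qed

text \<open>Young's inequality: the defect of the bound is the square of
  \<open>t \<bar>y\<bar> - \<bar>x - y\<bar>\<close> over \<open>t\<close>.\<close>
lemma power2_norm_le_weighted:
  fixes x y :: "'a::real_inner"
  assumes "t > 0"
  shows "(norm x)\<^sup>2 \<le> (1 + t) * (norm y)\<^sup>2 + (1 + 1 / t) * (dist x y)\<^sup>2"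
proof -
  have "(norm x)\<^sup>2 \<le> (norm y + dist x y)\<^sup>2"
    by (intro power_mono) (auto simp: dist_norm norm_triangle_sub)
  also have "\<dots> = (1 + t) * (norm y)\<^sup>2 + (1 + 1 / t) * (dist x y)\<^sup>2 - (t * norm y - dist x y)\<^sup>2 / t"
    using assms by (simp add: power2_eq_square field_simps)
  finally show ?thesis using assms by (smt (verit) divide_nonneg_pos zero_le_power2)
qed

text \<open>This stands in for the triangle inequality through a point mass at the origin. The
  pointwise weighted inequality, integrated against any coupling, gives a lower bound on its cost
  that depends only on the marginals, hence a lower bound on the infimum. The free weight \<open>t\<close> is later
  taken to be the distance itself, which makes the first summand lower order and the constant
  of the second close to 1.\<close>
lemma second_moment_le:
  assumes "\<mu> \<in> wasserstein_space" "\<nu> \<in> wasserstein_space" "t > 0"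
  shows "second_moment \<mu> \<le> (1 + t) * second_moment \<nu> + (1 + 1 / t) * (wasserstein_dist \<mu> \<nu>)\<^sup>2"
proof -
  note mu [measurable_cong] = wasserstein_spaceD[OF assms(1)]
  note nu [measurable_cong] = wasserstein_spaceD[OF assms(2)]
  \<comment> \<open>the inequality solved for the cost; it may be negative, which \<open>ennreal\<close> truncates harmlessly\<close>
  define c where "c = (second_moment \<mu> - (1 + t) * second_moment \<nu>) / (1 + 1 / t)"
  have pos: "1 + 1 / t > 0" using assms(3) by (simp add: add_pos_pos)
  have "ennreal c \<le> (INF \<gamma>\<in>couplings \<mu> \<nu>. \<integral>\<^sup>+ (x, y). ennreal ((dist x y)\<^sup>2) \<partial>\<gamma>)"
  proof (rule INF_greatest)
    fix \<gamma> assume "\<gamma> \<in> couplings \<mu> \<nu>"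
    then have g: "sets \<gamma> = sets borel" "distr \<gamma> borel fst = \<mu>" "distr \<gamma> borel snd = \<nu>"
      by (auto simp: couplings_def)
    note g(1)[measurable_cong]
    have m [measurable]: "fst \<in> borel_measurable \<gamma>" "snd \<in> borel_measurable \<gamma>"
      by (simp_all add: measurable_cong_sets[OF g(1) refl] borel_measurable_continuous_onI continuous_on_fst continuous_on_snd)
    show "ennreal c \<le> (\<integral>\<^sup>+ (x, y). ennreal ((dist x y)\<^sup>2) \<partial>\<gamma>)" (is "_ \<le> ?K")
    proof (cases "?K = \<top>")
      case False
      have K: "?K = (\<integral>\<^sup>+ z. ennreal ((dist (fst z) (snd z))\<^sup>2) \<partial>\<gamma>)"
        by (simp add: case_prod_unfold)
      have i3: "integrable \<gamma> (\<lambda>z. (dist (fst z) (snd z))\<^sup>2)"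
        by (rule integrableI_nonneg) (use False K in \<open>auto simp: less_top\<close>)
      have i1: "integrable \<gamma> (\<lambda>z. (norm (fst z))\<^sup>2)"
        using integrable_distr_eq[of fst \<gamma> borel "\<lambda>x. (norm x)\<^sup>2"] mu(3) by (simp add: g)
      have i2: "integrable \<gamma> (\<lambda>z. (norm (snd z))\<^sup>2)"
        using integrable_distr_eq[of snd \<gamma> borel "\<lambda>x. (norm x)\<^sup>2"] nu(3) by (simp add: g)
      have e1: "(\<integral>z. (norm (fst z))\<^sup>2 \<partial>\<gamma>) = second_moment \<mu>"
        using integral_distr[of fst \<gamma> borel "\<lambda>x. (norm x)\<^sup>2"] by (simp add: g second_moment_def)
      have e2: "(\<integral>z. (norm (snd z))\<^sup>2 \<partial>\<gamma>) = second_moment \<nu>"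
        using integral_distr[of snd \<gamma> borel "\<lambda>x. (norm x)\<^sup>2"] by (simp add: g second_moment_def)
      let ?k = "\<integral>z. (dist (fst z) (snd z))\<^sup>2 \<partial>\<gamma>"
      have "(\<integral>z. (norm (fst z))\<^sup>2 \<partial>\<gamma>) \<le>
          (\<integral>z. (1 + t) * (norm (snd z))\<^sup>2 + (1 + 1 / t) * (dist (fst z) (snd z))\<^sup>2 \<partial>\<gamma>)"
        by (rule integral_mono) (use i1 i2 i3 power2_norm_le_weighted[OF assms(3)] in auto)
      then have "second_moment \<mu> \<le> (1 + t) * second_moment \<nu> + (1 + 1 / t) * ?k"
        using i2 i3 by (simp add: e1 e2)
      then have "c \<le> ?k"
        using pos by (simp add: c_def pos_divide_le_eq mult.commute)
      then show ?thesis
        unfolding K by (subst nn_integral_eq_integral[OF i3]) (auto intro: ennreal_leI)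
    qed simp
  qed
  then have "ennreal c \<le> ennreal ((wasserstein_dist \<mu> \<nu>)\<^sup>2)"
    by (simp add: wasserstein_cost_eq[OF assms(1,2)])
  then have "c \<le> (wasserstein_dist \<mu> \<nu>)\<^sup>2" by simp
  then show ?thesis using pos by (simp add: c_def pos_divide_le_eq mult.commute)
qed

section \<open>Orthonormal families\<close>

lemma orthonormal_family_card_le:
  fixes f :: "'i::finite \<Rightarrow> 'a::euclidean_space"
  assumes unit: "\<And>i. norm (f i) = 1" and orth: "\<And>i j. i \<noteq> j \<Longrightarrow> f i \<bullet> f j = 0"
  shows "CARD('i) \<le> DIM('a)"
proof -
  have inj: "inj f"
  proof (rule injI, rule ccontr)
    fix i j assume "f i = f j" "i \<noteq> j"
    then show False using orth[of i j] unit[of j] by (simp add: norm_eq_1)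
  qed
  have "independent (range f)"
  proof (rule pairwise_orthogonal_independent)
    show "pairwise orthogonal (range f)"
      using orth unfolding pairwise_def orthogonal_def by (metis imageE)
    show "0 \<notin> range f" using unit by (metis norm_zero rangeE zero_neq_one)
  qed
  then have "card (range f) \<le> DIM('a)" by (rule independent_card_le)
  then show ?thesis by (simp add: card_image[OF inj])
qed

text \<open>The equality case of Cauchy-Schwarz forces \<open>q i = - p i\<close>. Then the upper
  bound on the inner product of \<open>p i\<close> with \<open>q j\<close> is a lower bound on that
  of \<open>p i\<close> with \<open>p j\<close>, so one-sided estimates suffice for
  orthogonality.\<close>
lemma orthonormal_of_inner_bounds:
  fixes p q :: "'i \<Rightarrow> 'a::real_inner"
  assumes p: "\<And>i. norm (p i) \<le> 1" and q: "\<And>i. norm (q i) \<le> 1"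
    and opp: "\<And>i. p i \<bullet> q i \<le> - 1"
    and pp: "\<And>i j. i \<noteq> j \<Longrightarrow> p i \<bullet> p j \<le> 0"
    and pq: "\<And>i j. i \<noteq> j \<Longrightarrow> p i \<bullet> q j \<le> 0"
  shows "norm (p i) = 1" and "i \<noteq> j \<Longrightarrow> p i \<bullet> p j = 0"
proof -
  have sq: "p i \<bullet> p i \<le> 1" "q i \<bullet> q i \<le> 1" for i
    using p[of i] q[of i] by (simp_all add: norm_le_square)
  have neg: "q i = - p i" for i
  proof -
    have "(p i + q i) \<bullet> (p i + q i) = p i \<bullet> p i + q i \<bullet> q i + 2 * (p i \<bullet> q i)"
      by (simp add: inner_add inner_commute)
    also have "\<dots> \<le> 0" using sq[of i] opp[of i] by linarith
    finally have "(p i + q i) \<bullet> (p i + q i) = 0" by (rule antisym) (rule inner_ge_zero)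
    then have "q i + p i = 0" by (simp only: inner_eq_zero_iff add.commute)
    then show ?thesis by (simp only: eq_neg_iff_add_eq_0)
  qed
  show "norm (p i) = 1" using sq(1)[of i] opp[of i] by (auto simp: neg norm_eq_1)
  show "p i \<bullet> p j = 0" if "i \<noteq> j" using pp[OF that] pq[OF that] by (auto simp: neg)
qed

section \<open>Non-embeddability\<close>

theorem theorem1p3:
  assumes "CARD('m::finite) = CARD('n::finite) + 1"
  shows "\<not> (\<exists>\<phi> :: real ^ 'm \<Rightarrow> (real ^ 'n) measure.
            isometric_embedding UNIV dist wasserstein_space wasserstein_dist \<phi>)"
proof
  assume "\<exists>\<phi> :: real ^ 'm \<Rightarrow> (real ^ 'n) measure.
            isometric_embedding UNIV dist wasserstein_space wasserstein_dist \<phi>"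
  then obtain \<phi> :: "real ^ 'm \<Rightarrow> (real ^ 'n) measure"
    where W: "\<And>x. \<phi> x \<in> wasserstein_space"
      and iso: "\<And>x y. wasserstein_dist (\<phi> x) (\<phi> y) = dist x y"
    unfolding isometric_embedding_def by blast
  define A where "A = second_moment (\<phi> 0)"
  \<comment> \<open>\<open>\<delta> t\<close> bounds the relative excess of the second moment at distance \<open>t\<close> from the origin\<close>
  define \<delta> where "\<delta> t = ((1 + t) * A + t) / t\<^sup>2" for t
  define B where "B t u = barycenter (\<phi> (t *\<^sub>R u)) /\<^sub>R t" for t u
  have \<delta>: "(\<lambda>k. \<delta> (real (Suc k))) \<longlonglongrightarrow> 0"
    unfolding \<delta>_def by real_asymp
  have moment: "second_moment (\<phi> (t *\<^sub>R u)) \<le> t\<^sup>2 * (1 + \<delta> t)" if "t > 0" "norm u = 1" for t u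
  proof -
    \<comment> \<open>the weight in Young's inequality is the distance itself, so that \<open>(1 + 1 / t) t\<^sup>2 = t\<^sup>2 + t\<close>\<close>
    have "second_moment (\<phi> (t *\<^sub>R u)) \<le> (1 + t) * A + (1 + 1 / t) * t\<^sup>2"
      using second_moment_le[OF W W that(1), of "t *\<^sub>R u" 0] that by (simp add: iso A_def)
    also have "\<dots> = t\<^sup>2 * (1 + \<delta> t)"
      using that by (simp add: \<delta>_def field_simps power2_eq_square)
    finally show ?thesis .
  qed
  have norm_B: "(norm (B t u))\<^sup>2 \<le> 1 + \<delta> t" if "t > 0" "norm u = 1" for t u
    using order_trans[OF norm_barycenter_le[OF W] moment[OF that]] that
    by (simp add: B_def power_mult_distrib power_inverse field_simps)
  have inner_B: "B t u \<bullet> B t v \<le> u \<bullet> v + \<delta> t" if "t > 0" "norm u = 1" "norm v = 1" for t u v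
  proof -
    let ?i = "barycenter (\<phi> (t *\<^sub>R u)) \<bullet> barycenter (\<phi> (t *\<^sub>R v))"
    have "(dist (t *\<^sub>R u) (t *\<^sub>R v))\<^sup>2 = t\<^sup>2 * (2 - 2 * (u \<bullet> v))"
    proof -
      have "dist (t *\<^sub>R u) (t *\<^sub>R v) = t * dist u v"
        using that(1) by (simp add: dist_norm flip: scaleR_diff_right)
      moreover have "(dist u v)\<^sup>2 = 2 - 2 * (u \<bullet> v)"
        using that(2,3) by (simp add: dist_norm power2_norm_diff)
      ultimately show ?thesis by (simp add: power_mult_distrib)
    qed
    then have "t\<^sup>2 * (2 - 2 * (u \<bullet> v)) \<le> 2 * (t\<^sup>2 * (1 + \<delta> t)) - 2 * ?i"
      using wasserstein_dist_le_product_cost[OF W W, of "t *\<^sub>R u" "t *\<^sub>R v"]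
        moment[OF that(1,2)] moment[OF that(1,3)] by (simp add: iso)
    then have "?i \<le> t\<^sup>2 * (u \<bullet> v + \<delta> t)" by (simp add: algebra_simps)
    then show ?thesis using that
      by (simp add: B_def field_simps power2_eq_square)
  qed
  \<comment> \<open>All basis directions and their negatives are collected in one vector, so that a single
    subsequence serves them all; \<open>Suc k\<close> keeps the scale positive.\<close>
  define P where "P k = ((\<chi> i. B (real (Suc k)) (axis i 1)), (\<chi> i. B (real (Suc k)) (- axis i 1)))"
    for k :: nat
  have fst_P [simp]: "fst (P k) $ i = B (real (Suc k)) (axis i 1)"
    and snd_P [simp]: "snd (P k) $ i = B (real (Suc k)) (- axis i 1)" for k and i :: 'm
    by (simp_all add: P_def)
  have "bounded (range P)"
  proof -
    obtain K where K: "\<And>k. \<bar>\<delta> (real (Suc k))\<bar> \<le> K"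
      using Bseq_eq_bounded convergentI[OF \<delta>] convergent_imp_Bseq by (metis BseqE real_norm_def)
    have bd: "norm (B (real (Suc k)) u) \<le> 1 + K" if "norm u = 1" for k u
    proof (rule power2_le_imp_le)
      have "(norm (B (real (Suc k)) u))\<^sup>2 \<le> 1 + K"
        using norm_B[of "real (Suc k)" u] that K[of k] by simp
      also have "\<dots> \<le> (1 + K)\<^sup>2"
        using K[of 0] by (simp add: self_le_power)
      finally show "(norm (B (real (Suc k)) u))\<^sup>2 \<le> (1 + K)\<^sup>2" .
    qed (use K[of 0] in simp)
    have "norm (P k) \<le> (\<Sum>i\<in>(UNIV :: 'm set). 1 + K) + (\<Sum>i\<in>(UNIV :: 'm set). 1 + K)" for k
    proof -
      have "norm (fst (P k)) \<le> (\<Sum>i\<in>UNIV. norm (fst (P k) $ i))"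
        "norm (snd (P k)) \<le> (\<Sum>i\<in>UNIV. norm (snd (P k) $ i))"
        unfolding norm_vec_def by (rule L2_set_le_sum, simp)+
      moreover have "(\<Sum>i\<in>UNIV. norm (fst (P k) $ i)) \<le> (\<Sum>i\<in>(UNIV :: 'm set). 1 + K)"
        "(\<Sum>i\<in>UNIV. norm (snd (P k) $ i)) \<le> (\<Sum>i\<in>(UNIV :: 'm set). 1 + K)"
        by (rule sum_mono, simp only: fst_P snd_P, rule bd, simp)+
      ultimately show ?thesis
        using norm_Pair_le[of "fst (P k)" "snd (P k)"] unfolding prod.collapse by linarith
    qed
    then show ?thesis unfolding bounded_iff by blast
  qed
  then obtain l r where r: "strict_mono r" and lim: "(P \<circ> r) \<longlonglongrightarrow> l"
    using bounded_imp_convergent_subsequence[of P] by blast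
  have \<delta>r: "(\<lambda>k. a + \<delta> (real (Suc (r k)))) \<longlonglongrightarrow> a" for a
    using tendsto_add[OF tendsto_const LIMSEQ_subseq_LIMSEQ[OF \<delta> r], of a] by (simp add: comp_def)
  define p where "p i = fst l $ i" for i
  define q where "q i = snd l $ i" for i
  have lim_p: "(\<lambda>k. B (real (Suc (r k))) (axis i 1)) \<longlonglongrightarrow> p i" for i
    using tendsto_vec_nth[OF tendsto_fst[OF lim], of i] by (simp add: p_def)
  have lim_q: "(\<lambda>k. B (real (Suc (r k))) (- axis i 1)) \<longlonglongrightarrow> q i" for i
    using tendsto_vec_nth[OF tendsto_snd[OF lim], of i] by (simp add: q_def)
  have norm_lim: "norm a \<le> 1"
    if "(\<lambda>k. B (real (Suc (r k))) u) \<longlonglongrightarrow> a" "norm u = 1" for a u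
  proof -
    have "(norm a)\<^sup>2 \<le> 1"
      by (rule LIMSEQ_le[OF tendsto_power[OF tendsto_norm[OF that(1)]] \<delta>r])
        (use norm_B that in auto)
    then show ?thesis by (simp add: power2_le_iff_abs_le abs_square_le_1)
  qed
  have inner_lim: "a \<bullet> b \<le> u \<bullet> v"
    if "(\<lambda>k. B (real (Suc (r k))) u) \<longlonglongrightarrow> a" "(\<lambda>k. B (real (Suc (r k))) v) \<longlonglongrightarrow> b"
       "norm u = 1" "norm v = 1" for a b u v
    by (rule LIMSEQ_le[OF tendsto_inner[OF that(1,2)] \<delta>r]) (use inner_B that in auto)
  have np: "norm (p i) \<le> 1" and nq: "norm (q i) \<le> 1" for i
    using norm_lim[OF lim_p] norm_lim[OF lim_q] by simp_all
  have opp: "p i \<bullet> q i \<le> - 1" for i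
    using inner_lim[OF lim_p[of i] lim_q[of i]] by (simp add: inner_axis_axis)
  have pp: "p i \<bullet> p j \<le> 0" and pq: "p i \<bullet> q j \<le> 0" if "i \<noteq> j" for i j
    using inner_lim[OF lim_p[of i] lim_p[of j]] inner_lim[OF lim_p[of i] lim_q[of j]] that
    by (simp_all add: inner_axis_axis)
  have "norm (p i) = 1" for i
    by (rule orthonormal_of_inner_bounds(1)[of p q, OF np nq opp pp pq])
  moreover have "p i \<bullet> p j = 0" if "i \<noteq> j" for i j
    by (rule orthonormal_of_inner_bounds(2)[of p q, OF np nq opp pp pq that])
  ultimately have "CARD('m) \<le> DIM(real ^ 'n)" by (rule orthonormal_family_card_le)
  then show False using assms by simp
qed

end
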